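(* Let $n,k$ be positive integers with $k\le n$ and let $\mathcal{F}=\binom{[n]}{k}\cup\binom{[n]}{k+1}\cup\dots\cup\binom{[n]}{n}$. Then $\frac{n-k+1}{2}\le\beta_{[\pm1]}(\mathcal{F})\le\min\{\frac n2, n-k+1\}$.
   Context: For a positive integer $n$, $[n]=\{1,\dots,n\}$ and $\binom{[n]}{j}$ is the family of all $j$-element subsets of $[n]$. For a set $D$ of integers and families $\mathcal{F},\mathcal{F}'$ of subsets of $[n]$, $\mathcal{F}'$ is called $D$-secting for $\mathcal{F}$ if for every $A\in\mathcal{F}$ there exists $A'\in\mathcal{F}'$ with $|A\cap A'|-|A\cap([n]\setminus A')|\in D$. $\beta_D(\mathcal{F})$ is the minimum cardinality of a $D$-secting family for $\mathcal{F}$; $\beta_{[\pm 1]}$ denotes $\beta_D$ with $D=\{-1,0,1\}$.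
   Formalization: The upper bound n/2 is replaced by its ceiling ⌈n/2⌉, because the printed bound fails for odd n (for n = k = 1, β = 1 > 1/2); for even n nothing changes. *)

theory Defs
  imports Complex_Main
begin

definition layer :: "nat \<Rightarrow> nat \<Rightarrow> nat set set" where
  "layer n j = {A. A \<subseteq> {1..n} \<and> card A = j}"

definition secting :: "nat \<Rightarrow> int set \<Rightarrow> nat set set \<Rightarrow> nat set set \<Rightarrow> bool" where
  "secting n D \<F> \<F>' \<longleftrightarrow>
     (\<forall>A\<in>\<F>. \<exists>A'\<in>\<F>'. int (card (A \<inter> A')) - int (card (A \<inter> ({1..n} - A'))) \<in> D)"

text \<open>
  The minimum is over a finite set of numbers, since there are only finitely many families
  of subsets of \<open>{1..n}\<close>. It is nonempty whenever \<open>{-1, 0, 1} \<subseteq> D\<close> and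
  \<open>\<F> \<subseteq> Pow {1..n}\<close>: the family of all subsets of \<open>{1..n}\<close> is then secting.
\<close>

definition beta :: "nat \<Rightarrow> int set \<Rightarrow> nat set set \<Rightarrow> nat" where
  "beta n D \<F> = Min {card \<F>' | \<F>'. \<F>' \<subseteq> Pow {1..n} \<and> secting n D \<F> \<F>'}"

end

theory Submission
  imports Defs
begin

text \<open>
  Upper bounds: along the prefixes \<open>{1..i}\<close>, or along the windows of length \<open>\<lceil>n/2\<rceil>\<close>, the size of
  the intersection with a fixed set changes by at most one per step, so a discrete intermediate
  value argument finds a member that halves the set.

  Lower bound: assign to each of the \<open>m\<close> members of a secting family the discrepancy function,
  which is linear in the indicator vector of \<open>A\<close> and has the parity of \<open>card A\<close>. The square of the
  product of these functions has degree \<open>2 * m\<close>, vanishes on the even sets of size at least \<open>k\<close>,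
  and is positive on all odd sets. If \<open>2 * m < n - k + 1\<close>, its alternating sum over the cube of
  all sets between some \<open>T\<close> of size \<open>k - 1\<close> and \<open>{1..n}\<close> is zero, which is impossible once the
  square also vanishes at \<open>T\<close> or \<open>card T\<close> is odd. For even \<open>card T\<close> one chooses \<open>T\<close> balanced with
  respect to a member that almost halves \<open>{1..n}\<close>.
\<close>

section \<open>Discrepancies and the minimum\<close>

text \<open>A sum of signs rather than a difference of cardinalities: linearity in the indicator
  vector of \<open>A\<close> is then visible, and the lower bound rests on it.\<close>

definition disc :: "'a set \<Rightarrow> 'a set \<Rightarrow> int" where
  "disc X A = (\<Sum>a\<in>A. if a \<in> X then 1 else - 1)"

lemma disc_eq_card_diff:
  assumes "finite A"
  shows "disc X A = int (card (A \<inter> X)) - int (card (A - X))"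
  using assms by (simp add: disc_def sum.If_cases Collect_neg_eq Diff_eq)

lemma disc_eq_twice_card:
  assumes "finite A"
  shows "disc X A = 2 * int (card (A \<inter> X)) - int (card A)"
proof -
  have "card A = card (A \<inter> X) + card (A - X)"
    using card_Int_Diff[OF assms] .
  then show ?thesis
    using disc_eq_card_diff[OF assms, of X] by simp
qed

lemma odd_disc_iff:
  assumes "finite A"
  shows "odd (disc X A) \<longleftrightarrow> odd (card A)"
  using disc_eq_twice_card[OF assms, of X] by simp

lemma disc_union_disjoint:
  assumes "finite A" "finite B" "A \<inter> B = {}"
  shows "disc X (A \<union> B) = disc X A + disc X B"
  using assms by (simp add: disc_def sum.union_disjoint)

lemma secting_iff_disc:
  assumes "\<F> \<subseteq> Pow {1..n}"
  shows "secting n D \<F> \<G> \<longleftrightarrow> (\<forall>A\<in>\<F>. \<exists>X\<in>\<G>. disc X A \<in> D)"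
proof -
  have "int (card (A \<inter> X)) - int (card (A \<inter> ({1..n} - X))) = disc X A" if "A \<in> \<F>" for A X
  proof -
    have A: "A \<subseteq> {1..n}" using that assms by blast
    then have "A \<inter> ({1..n} - X) = A - X" by blast
    then show ?thesis
      using disc_eq_card_diff[of A X] finite_subset[OF A] by simp
  qed
  then show ?thesis unfolding secting_def by simp
qed

text \<open>Reduces near-balance to hitting the half of \<open>card A\<close> rounded down or up, a
  target for intermediate value arguments.\<close>

lemma disc_small_iff:
  assumes "finite A"
  shows "disc X A \<in> {-1, 0, 1} \<longleftrightarrow>
    card (A \<inter> X) = card A div 2 \<or> card (A \<inter> X) = card A - card A div 2"
proof -
  have "2 * int x - int c \<in> {-1, 0, 1} \<longleftrightarrow> x = c div 2 \<or> x = c - c div 2" for x c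
    by (cases "even c") (auto elim!: evenE oddE)
  then show ?thesis unfolding disc_eq_twice_card[OF assms] .
qed

section \<open>The minimum over secting families\<close>

lemma finite_secting_cards:
  "finite {card \<G> | \<G>. \<G> \<subseteq> Pow {1..n} \<and> secting n D \<F> \<G>}"
proof -
  have "{card \<G> | \<G>. \<G> \<subseteq> Pow {1..n} \<and> secting n D \<F> \<G>} \<subseteq> card ` Pow (Pow {1..n})"
    by blast
  then show ?thesis by (rule finite_subset) simp
qed

lemma beta_le:
  assumes "\<G> \<subseteq> Pow {1..n}" "secting n D \<F> \<G>"
  shows "beta n D \<F> \<le> card \<G>"
  unfolding beta_def using assms by (intro Min_le[OF finite_secting_cards]) blast

lemma beta_attained:
  assumes "\<G> \<subseteq> Pow {1..n}" "secting n D \<F> \<G>"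
  obtains \<H> where "\<H> \<subseteq> Pow {1..n}" "secting n D \<F> \<H>" "card \<H> = beta n D \<F>"
proof -
  have "beta n D \<F> \<in> {card \<G> | \<G>. \<G> \<subseteq> Pow {1..n} \<and> secting n D \<F> \<G>}"
    unfolding beta_def using assms by (intro Min_in[OF finite_secting_cards]) blast
  then show ?thesis using that by force
qed

lemma mem_upper_layers_iff:
  "A \<in> (\<Union>j\<in>{k..n}. layer n j) \<longleftrightarrow> A \<subseteq> {1..n} \<and> k \<le> card A"
  using card_mono[of "{1..n}" A] by (auto simp: layer_def)

section \<open>Upper bounds\<close>

lemma card_Int_prefix_Suc:
  "card (A \<inter> {1..Suc i}) = card (A \<inter> {1..i}) + (if Suc i \<in> A then 1 else 0)"
proof -
  have "A \<inter> {1..Suc i} = (if Suc i \<in> A then insert (Suc i) (A \<inter> {1..i}) else A \<inter> {1..i})"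
    by (auto simp: le_Suc_eq)
  then show ?thesis by simp
qed

lemma card_Int_window:
  "int (card (A \<inter> {i<..i + m})) = int (card (A \<inter> {1..i + m :: nat})) - int (card (A \<inter> {1..i}))"
proof -
  have "{1..i + m} = {1..i} \<union> {i<..i + m}" by auto
  then have "A \<inter> {1..i + m} = A \<inter> {1..i} \<union> A \<inter> {i<..i + m}" by blast
  moreover have "(A \<inter> {1..i}) \<inter> (A \<inter> {i<..i + m}) = {}" by auto
  ultimately have "card (A \<inter> {1..i + m}) = card (A \<inter> {1..i}) + card (A \<inter> {i<..i + m})"
    by (simp add: card_Un_disjoint)
  then show ?thesis by simp
qed

text \<open>The windows starting after \<open>0\<close> and after \<open>m\<close> are disjoint and
  together cover \<open>A\<close>, so their counts lie on both sides of \<open>card A / 2\<close>;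
  some window in between hits the half.\<close>

lemma halving_window_exists:
  fixes n m :: nat
  assumes A: "A \<subseteq> {1..n}" and m: "n \<le> 2 * m" "0 < m"
  shows "\<exists>i<m. disc ({i<..i + m} \<inter> {1..n}) A \<in> {-1, 0, 1}"
proof -
  define f where "f i = int (card (A \<inter> {i<..i + m}))" for i
  define c where "c = int (card A div 2)"
  have fin: "finite A" using finite_subset[OF A] by simp
  have step: "\<bar>f (Suc i) - f i\<bar> \<le> 1" for i
    using card_Int_prefix_Suc[of A i] card_Int_prefix_Suc[of A "i + m"]
    unfolding f_def card_Int_window by simp
  have "A \<inter> {1..m + m} = A" using A m by auto
  then have ends: "f 0 + f m = int (card A)"
    unfolding f_def card_Int_window by simp
  have "\<exists>i\<le>m. f i = c"
  proof (cases "f 0 \<le> c")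
    case True
    with ends have "c \<le> f m" unfolding c_def by linarith
    with True show ?thesis
      using nat0_intermed_int_val[of m f c] step by simp
  next
    case False
    with ends have "f m \<le> c" unfolding c_def by linarith
    \<comment> \<open>The counts descend through \<open>c\<close> here, hence the passage to
      \<open>- f\<close>.\<close>
    moreover have "\<bar>- f (Suc i) - - f i\<bar> \<le> 1" for i using step[of i] by linarith
    ultimately show ?thesis
      using nat0_intermed_int_val[of m "\<lambda>i. - f i" "- c"] False by force
  qed
  then obtain i where i: "i \<le> m" "f i = c" by blast
  \<comment> \<open>Only \<open>m\<close> windows are allowed. If the hit is at
    \<open>i = m\<close>, the complementary window at \<open>0\<close> holds the other half.\<close>
  have "\<exists>i<m. f i = int (card A div 2) \<or> f i = int (card A - card A div 2)"
  proof (cases "i = m")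
    case True
    then have "f 0 = int (card A - card A div 2)" using ends i unfolding c_def by simp
    then show ?thesis using m by blast
  next
    case False
    then show ?thesis using i unfolding c_def by force
  qed
  moreover have "A \<inter> ({i<..i + m} \<inter> {1..n}) = A \<inter> {i<..i + m}" for i using A by blast
  ultimately show ?thesis
    unfolding disc_small_iff[OF fin] f_def of_nat_eq_iff by simp
qed

text \<open>The shortest prefix has only \<open>k - k div 2\<close> elements, and the longest misses
  at most \<open>k div 2\<close> elements of \<open>A\<close>. As \<open>k \<le> card A\<close>, the
  upper half of \<open>card A\<close> lies between their counts.\<close>

lemma halving_prefix_exists:
  assumes A: "A \<subseteq> {1..n}" and k: "k \<le> card A"
  shows "\<exists>i\<in>{k - k div 2..n - k div 2}. disc {1..i} A \<in> {-1, 0, 1}"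
proof -
  define g where "g i = int (card (A \<inter> {1..i}))" for i
  define c where "c = int (card A - card A div 2)"
  have fin: "finite A" using finite_subset[OF A] by simp
  have kn: "k \<le> n" using card_mono[OF _ A] k by simp
  have step: "\<bar>g (Suc i) - g i\<bar> \<le> 1" for i
    using card_Int_prefix_Suc[of A i] unfolding g_def by simp
  have "card (A \<inter> {1..k - k div 2}) \<le> k - k div 2"
    using card_mono[of "{1..k - k div 2}" "A \<inter> {1..k - k div 2}"] by simp
  then have lo: "g (k - k div 2) \<le> c" using k unfolding g_def c_def by linarith
  have "A \<subseteq> (A \<inter> {1..n - k div 2}) \<union> {n - k div 2<..n}" using A by auto
  then have "card A \<le> card (A \<inter> {1..n - k div 2} \<union> {n - k div 2<..n})"
    by (intro card_mono) auto
  also have "\<dots> \<le> card (A \<inter> {1..n - k div 2}) + card {n - k div 2<..n}"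
    by (rule card_Un_le)
  finally have hi: "c \<le> g (n - k div 2)" using k kn unfolding g_def c_def by simp
  obtain i where "i \<in> {k - k div 2..n - k div 2}" "g i = c"
    using nat_intermed_int_val[of "k - k div 2" "n - k div 2" g c] step lo hi kn by force
  then show ?thesis
    unfolding disc_small_iff[OF fin] g_def c_def of_nat_eq_iff by blast
qed

section \<open>Lower bound\<close>

lemma sum_Pow_insert:
  fixes h :: "'a set \<Rightarrow> 'b::comm_monoid_add"
  assumes "finite S" "s \<notin> S"
  shows "(\<Sum>B\<in>Pow (insert s S). h B) = (\<Sum>B\<in>Pow S. h B + h (insert s B))"
proof -
  have "inj_on (insert s) (Pow S)" using assms(2) by (auto simp: inj_on_def)
  moreover have "Pow S \<inter> insert s ` Pow S = {}" using assms(2) by blast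
  ultimately show ?thesis
    using assms(1) by (simp add: Pow_insert sum.union_disjoint sum.reindex sum.distrib)
qed

text \<open>Each element of \<open>S\<close> contributes one finite difference, which lowers the
  degree of the product; more differences than factors leave nothing.\<close>

lemma alternating_sum_prod_affine_eq_0:
  fixes c :: "'i \<Rightarrow> 'b::comm_ring_1" and w :: "'i \<Rightarrow> 'a \<Rightarrow> 'b"
  assumes "finite S" "finite I" "card I < card S"
  shows "(\<Sum>B\<in>Pow S. (- 1) ^ card B * (\<Prod>i\<in>I. c i + (\<Sum>b\<in>B. w i b))) = 0"
  using assms
proof (induction S arbitrary: I rule: finite_induct)
  case empty
  then show ?case by simp
next
  case (insert s S)
  define g where "g i B = c i + (\<Sum>b\<in>B. w i b)" for i B
  have "(- 1) ^ card B * (\<Prod>i\<in>I. g i B)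
          + (- 1) ^ card (insert s B) * (\<Prod>i\<in>I. g i (insert s B))
        = - (\<Sum>J\<in>Pow I - {I}. (\<Prod>i\<in>I - J. w i s) * ((- 1) ^ card B * (\<Prod>i\<in>J. g i B)))"
    if "B \<in> Pow S" for B
  proof -
    have B: "finite B" "s \<notin> B" using that insert.hyps finite_subset by auto
    have "(\<Prod>i\<in>I. g i (insert s B)) = (\<Prod>i\<in>I. g i B + w i s)"
      using B by (simp add: g_def algebra_simps)
    also have "\<dots> = (\<Sum>J\<in>Pow I. (\<Prod>i\<in>J. g i B) * (\<Prod>i\<in>I - J. w i s))"
      using insert.prems(1) by (rule prod_add)
    \<comment> \<open>The summand \<open>J = I\<close> is the product at \<open>B\<close> itself and
      cancels, since \<open>B\<close> and \<open>insert s B\<close> have opposite signs.\<close>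
    also have "\<dots> = (\<Prod>i\<in>I. g i B)
        + (\<Sum>J\<in>Pow I - {I}. (\<Prod>i\<in>J. g i B) * (\<Prod>i\<in>I - J. w i s))"
      using insert.prems(1) by (subst sum.remove[of _ I]) auto
    finally show ?thesis
      using B by (simp add: algebra_simps sum_distrib_left sum_negf)
  qed
  then have "(\<Sum>B\<in>Pow (insert s S). (- 1) ^ card B * (\<Prod>i\<in>I. g i B))
      = - (\<Sum>B\<in>Pow S. \<Sum>J\<in>Pow I - {I}.
            (\<Prod>i\<in>I - J. w i s) * ((- 1) ^ card B * (\<Prod>i\<in>J. g i B)))"
    using insert.hyps by (simp add: sum_Pow_insert sum_negf)
  also have "\<dots> = - (\<Sum>J\<in>Pow I - {I}. (\<Prod>i\<in>I - J. w i s) *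
            (\<Sum>B\<in>Pow S. (- 1) ^ card B * (\<Prod>i\<in>J. g i B)))"
    by (subst sum.swap) (simp add: sum_distrib_left)
  also have "\<dots> = 0"
  proof -
    have "(\<Sum>B\<in>Pow S. (- 1) ^ card B * (\<Prod>i\<in>J. g i B)) = 0" if "J \<in> Pow I - {I}" for J
    proof -
      have "J \<subset> I" using that by blast
      then have "card J < card I" "finite J"
        using insert.prems(1) psubset_card_mono finite_subset by auto
      then show ?thesis
        unfolding g_def using insert.IH insert.prems(2) insert.hyps by simp
    qed
    then show ?thesis by simp
  qed
  finally show ?case unfolding g_def .
qed

lemma cube_dim_le_twice_card:
  assumes fin: "finite \<G>" "finite S" "finite T" and disj: "T \<inter> S = {}"
    and S: "S \<noteq> {}"
    and zero: "\<And>B. B \<subseteq> S \<Longrightarrow> even (card (T \<union> B)) \<Longrightarrow> \<exists>X\<in>\<G>. disc X (T \<union> B) = 0"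
  shows "card S \<le> 2 * card \<G>"
proof (rule ccontr)
  assume less: "\<not> card S \<le> 2 * card \<G>"
  define P where "P B = (\<Prod>X\<in>\<G>. disc X (T \<union> B))" for B
  \<comment> \<open>Pairing with \<open>bool\<close> repeats each factor, so the square is a product
    of \<open>2 * card \<G>\<close> affine functions.\<close>
  have "(\<Sum>B\<in>Pow S. (- 1) ^ card B *
      (\<Prod>p\<in>\<G> \<times> (UNIV :: bool set). disc (fst p) T + (\<Sum>b\<in>B. if b \<in> fst p then 1 else - 1)))
      = (0 :: int)"
    using less fin
    by (intro alternating_sum_prod_affine_eq_0) (auto simp: card_cartesian_product)
  moreover have "(\<Prod>p\<in>\<G> \<times> (UNIV :: bool set).
      disc (fst p) T + (\<Sum>b\<in>B. if b \<in> fst p then 1 else - 1)) = (P B)\<^sup>2" if "B \<in> Pow S" for B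
  proof -
    have "finite B" "T \<inter> B = {}" using that fin disj finite_subset by auto
    then have "disc X (T \<union> B) = disc X T + (\<Sum>b\<in>B. if b \<in> X then 1 else - 1)" for X
      using disc_union_disjoint[OF fin(3)] by (simp add: disc_def[of X B])
    then show ?thesis
      by (simp add: P_def prod.cartesian_product' power2_eq_square UNIV_bool prod.distrib)
  qed
  ultimately have "(\<Sum>B\<in>Pow S. (- 1) ^ card B * (P B)\<^sup>2) = 0" by simp
  then have "(\<Sum>B\<in>Pow S. (- 1) ^ card T * ((- 1) ^ card B * (P B)\<^sup>2)) = 0"
    by (simp flip: sum_distrib_left)
  \<comment> \<open>The sign is now the parity of \<open>card (T \<union> B)\<close>. Even sets
    contribute zero and odd ones a negated square, so nothing can cancel.\<close>
  moreover have "(- 1) ^ card T * ((- 1) ^ card B * (P B)\<^sup>2) = - (P B)\<^sup>2" if "B \<in> Pow S" for B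
  proof -
    have "finite B" "T \<inter> B = {}" using that fin disj finite_subset by auto
    then have card: "card (T \<union> B) = card T + card B"
      using fin card_Un_disjoint by blast
    show ?thesis
    proof (cases "even (card (T \<union> B))")
      case True
      then have "P B = 0" using zero[of B] that fin unfolding P_def by auto
      then show ?thesis by simp
    next
      case False
      then have "(- 1 :: int) ^ (card T + card B) = - 1" using card by simp
      then show ?thesis by (simp add: power_add flip: mult.assoc)
    qed
  qed
  ultimately have "(\<Sum>B\<in>Pow S. (P B)\<^sup>2) = 0" by (simp add: sum_negf)
  then have all0: "P B = 0" if "B \<subseteq> S" for B
    using that fin by (simp add: sum_nonneg_eq_0_iff)
  obtain s where s: "s \<in> S" using S by blast
  \<comment> \<open>An odd set in the cube: no discrepancy vanishes on it, against
    \<open>all0\<close>.\<close>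
  define B where "B = (if odd (card T) then {} else {s})"
  have "odd (card (T \<union> B))" "B \<subseteq> S"
  proof -
    have "s \<notin> T" using s disj by blast
    then show "odd (card (T \<union> B))" "B \<subseteq> S" using s fin by (auto simp: B_def)
  qed
  then have "disc X (T \<union> B) \<noteq> 0" for X
    using odd_disc_iff[of "T \<union> B" X] fin finite_subset[of B S] by force
  then have "P B \<noteq> 0" using fin unfolding P_def by simp
  with all0 \<open>B \<subseteq> S\<close> show False by blast
qed

text \<open>Both \<open>U \<inter> X\<close> and \<open>U - X\<close> have at least
  \<open>card U div 2\<close> elements, so \<open>r\<close> can be taken from each.\<close>

lemma balanced_subset_exists:
  assumes "finite U" "2 * r \<le> card U" "disc X U \<in> {-1, 0, 1}"
  obtains T where "T \<subseteq> U" "card T = 2 * r" "disc X T = 0"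
proof -
  have "r \<le> card (U \<inter> X)" "r \<le> card (U - X)"
    using assms disc_small_iff[OF assms(1), of X] card_Int_Diff[OF assms(1), of X] by auto
  then obtain T1 T2 where T: "T1 \<subseteq> U \<inter> X" "card T1 = r" "T2 \<subseteq> U - X" "card T2 = r"
    by (meson obtain_subset_with_card_n)
  have fin: "finite T1" "finite T2" using T assms(1) finite_subset by blast+
  have "T1 \<inter> T2 = {}" using T by blast
  then have c: "card (T1 \<union> T2) = 2 * r" using fin T by (simp add: card_Un_disjoint)
  have "(T1 \<union> T2) \<inter> X = T1" using T by blast
  then have "disc X (T1 \<union> T2) = 0"
    using disc_eq_twice_card[of "T1 \<union> T2" X] fin c T by simp
  then show ?thesis using that[of "T1 \<union> T2"] T c by blast
qed

lemma secting_upper_layers_card_ge: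
  assumes k: "1 \<le> k" "k \<le> n" and \<G>: "\<G> \<subseteq> Pow {1..n}"
    and sec: "secting n {-1, 0, 1} (\<Union>j\<in>{k..n}. layer n j) \<G>"
  shows "n - k + 1 \<le> 2 * card \<G>"
proof -
  have "(\<Union>j\<in>{k..n}. layer n j) \<subseteq> Pow {1..n}" by (auto simp: layer_def)
  note sec' = sec[unfolded secting_iff_disc[OF this]]
  have small: "\<exists>X\<in>\<G>. disc X A \<in> {-1, 0, 1}" if "A \<subseteq> {1..n}" "k \<le> card A" for A
    using bspec[OF sec', of A] that unfolding mem_upper_layers_iff by simp
  have even_zero: "\<exists>X\<in>\<G>. disc X A = 0" if A: "A \<subseteq> {1..n}" "k \<le> card A" "even (card A)" for A
  proof -
    obtain X where "X \<in> \<G>" "disc X A \<in> {-1, 0, 1}" using small[OF A(1,2)] ..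
    moreover have "even (disc X A)"
      using odd_disc_iff[of A X] A(3) finite_subset[OF A(1)] by simp
    ultimately show ?thesis by auto
  qed
  \<comment> \<open>Starting the cube one level below the family gives dimension
    \<open>n - k + 1\<close>. The secting property does not cover its bottom \<open>T\<close>, which
    needs its own zero if \<open>card T\<close> is even.\<close>
  have "\<exists>T\<subseteq>{1..n}. card T = k - 1 \<and> (even (card T) \<longrightarrow> (\<exists>X\<in>\<G>. disc X T = 0))"
  proof (cases "even (k - 1)")
    case True
    then obtain r where r: "k - 1 = 2 * r" by blast
    have "2 * r \<le> card {1..n}" using r k by simp
    \<comment> \<open>The whole ground set belongs to the family, so some member nearly halves
      it.\<close>
    moreover obtain X where X: "X \<in> \<G>" "disc X {1..n} \<in> {-1, 0, 1}"
      using small[of "{1..n}"] k by auto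
    ultimately obtain T where "T \<subseteq> {1..n}" "card T = 2 * r" "disc X T = 0"
      using balanced_subset_exists[OF finite_atLeastAtMost] by blast
    then show ?thesis using X(1) r by auto
  next
    case False
    have "k - 1 \<le> card {1..n}" using k by simp
    then obtain T where "T \<subseteq> {1..n}" "card T = k - 1"
      by (rule obtain_subset_with_card_n)
    then show ?thesis using False by metis
  qed
  then obtain T where T: "T \<subseteq> {1..n}" "card T = k - 1"
    and T0: "even (card T) \<Longrightarrow> \<exists>X\<in>\<G>. disc X T = 0" by blast
  have finT: "finite T" using T(1) finite_subset by blast
  have cardS: "card ({1..n} - T) = n - k + 1" using T finT k by (simp add: card_Diff_subset)
  have "card ({1..n} - T) \<le> 2 * card \<G>"
  proof (rule cube_dim_le_twice_card)
    show "finite \<G>" using \<G> finite_subset by auto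
    show "{1..n} - T \<noteq> {}" using cardS by (metis Suc_eq_plus1 card.empty nat.distinct(1))
    fix B assume B: "B \<subseteq> {1..n} - T" "even (card (T \<union> B))"
    show "\<exists>X\<in>\<G>. disc X (T \<union> B) = 0"
    proof (cases "B = {}")
      case True
      then show ?thesis using T0 B by simp
    next
      case False
      have "finite B" "T \<inter> B = {}" using B finite_subset by auto
      then have "card (T \<union> B) = k - 1 + card B" "card B > 0"
        using finT T False by (simp_all add: card_Un_disjoint card_gt_0_iff)
      then have "k \<le> card (T \<union> B)" by linarith
      moreover have "T \<union> B \<subseteq> {1..n}" using B T by blast
      ultimately show ?thesis using even_zero B(2) by blast
    qed
  qed (use finT in auto)
  then show ?thesis using cardS by simp
qed

text \<open>The ceiling matters: for \<open>k = 1\<close> and odd \<open>n\<close> the lower bound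
  \<open>n / 2\<close> is not an integer, so \<open>beta\<close> exceeds it.\<close>

theorem theorem7:
  fixes n k :: nat
  assumes "n \<ge> 1" and "k \<ge> 1" and "k \<le> n"
  shows "(real n - real k + 1) / 2 \<le> real (beta n {-1, 0, 1} (\<Union>j\<in>{k..n}. layer n j)) \<and>
    real (beta n {-1, 0, 1} (\<Union>j\<in>{k..n}. layer n j))
      \<le> min (real_of_int \<lceil>real n / 2\<rceil>) (real n - real k + 1)"
proof -
  define \<F> where "\<F> = (\<Union>j\<in>{k..n}. layer n j)"
  define m where "m = (n + 1) div 2"
  define \<W> where "\<W> = (\<lambda>i. {i<..i + m} \<inter> {1..n}) ` {..<m}"
  \<comment> \<open>There are \<open>n - k + 1\<close> prefix lengths in this range.\<close>
  define \<P> where "\<P> = (\<lambda>i. {1..i}) ` {k - k div 2..n - k div 2}"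
  have \<F>: "\<F> \<subseteq> Pow {1..n}" by (auto simp: \<F>_def layer_def)
  have mem: "A \<in> \<F> \<longleftrightarrow> A \<subseteq> {1..n} \<and> k \<le> card A" for A
    unfolding \<F>_def by (rule mem_upper_layers_iff)
  have \<W>: "\<W> \<subseteq> Pow {1..n}" by (auto simp: \<W>_def)
  have \<P>: "\<P> \<subseteq> Pow {1..n}" by (auto simp: \<P>_def)
  have sec\<W>: "secting n {-1, 0, 1} \<F> \<W>"
    unfolding secting_iff_disc[OF \<F>]
  proof
    fix A assume "A \<in> \<F>"
    then have "\<exists>i<m. disc ({i<..i + m} \<inter> {1..n}) A \<in> {-1, 0, 1}"
      using assms mem by (intro halving_window_exists) (auto simp: m_def)
    then show "\<exists>X\<in>\<W>. disc X A \<in> {-1, 0, 1}" unfolding \<W>_def by blast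
  qed
  have sec\<P>: "secting n {-1, 0, 1} \<F> \<P>"
    unfolding secting_iff_disc[OF \<F>]
  proof
    fix A assume "A \<in> \<F>"
    then show "\<exists>X\<in>\<P>. disc X A \<in> {-1, 0, 1}"
      unfolding \<P>_def using halving_prefix_exists[of A n k] mem by blast
  qed
  have "beta n {-1, 0, 1} \<F> \<le> card \<W>" using \<W> sec\<W> by (rule beta_le)
  also have "\<dots> \<le> m" using card_image_le[of "{..<m}"] by (simp add: \<W>_def)
  finally have "int (beta n {-1, 0, 1} \<F>) \<le> int m" by simp
  also have "int m \<le> \<lceil>real n / 2\<rceil>" unfolding le_ceiling_iff m_def by linarith
  finally have up1: "real (beta n {-1, 0, 1} \<F>) \<le> real_of_int \<lceil>real n / 2\<rceil>" by linarith
  have "beta n {-1, 0, 1} \<F> \<le> card \<P>" using \<P> sec\<P> by (rule beta_le)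
  also have "\<dots> \<le> card {k - k div 2..n - k div 2}" unfolding \<P>_def by (rule card_image_le) simp
  also have "\<dots> = n - k + 1" using assms by simp
  finally have up2: "real (beta n {-1, 0, 1} \<F>) \<le> real n - real k + 1" using assms by linarith
  \<comment> \<open>\<open>\<W>\<close> shows that the minimum is over a nonempty set, hence
    attained.\<close>
  obtain \<H> where "\<H> \<subseteq> Pow {1..n}" "secting n {-1, 0, 1} \<F> \<H>" "card \<H> = beta n {-1, 0, 1} \<F>"
    using beta_attained[OF \<W> sec\<W>] .
  then have "n + 1 \<le> 2 * beta n {-1, 0, 1} \<F> + k"
    using secting_upper_layers_card_ge[of k n \<H>] assms unfolding \<F>_def by simp
  then have "(real n - real k + 1) / 2 \<le> real (beta n {-1, 0, 1} \<F>)"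
    using assms by simp
  with up1 up2 show ?thesis unfolding \<F>_def by simp
qed

end
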